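(* Let $\Omega\subset\mathbb{R}^n$ be a bounded $\mu$-measurable set, where $\mu$ is a lower Ahlfors $\beta$-regular measure in $\Omega$. Let $0<\alpha<\beta$ and let $p$ be an exponent on $\Omega$ such that $1<p_*\le p(x)\le p^*<\beta/\alpha$ for all $x\in\Omega$. Define $q$ by $1/q(x)=1/p(x)-\alpha/\beta$ and $s(x)=1+q(x)/p'(x)$. Then the inequality $$M_\alpha(f/w)(x)\le\Big(M\big(|f|^{p(\cdot)/s(\cdot)}w^{-q(\cdot)/s(\cdot)}\big)(x)\Big)^{s(x)/q(x)}\Big(\int_\Omega|f(y)|^{p(y)}\,d\mu(y)\Big)^{\alpha/\beta}$$ holds for every $x\in\Omega$, every function $f$ on $\Omega$ and every weight $w$ on $\Omega$.
   Context: $\mu$ is a non-negative Borel regular measure on $\mathbb{R}^n$. $Q=Q(x,l(Q))$ denotes a cube centered at $x$ with side length $l(Q)$ and sides parallel to the coordinate axes. The measure $\mu$ is lower Ahlfors $\beta$-regular in the bounded set $\Omega$ ($\beta>0$ a constant) if there is $c>0$ with $\mu(Q(x,l(Q)))\ge c\,l(Q)^{\beta}$ for every $x\in\Omega$ and every cube $Q=Q(x,l(Q))$ with $0<l(Q)<\mathrm{diam}(\Omega)$. An exponent is a $\mu$-measurable function $p:\Omega\to[1,\infty)$; $p_*=\inf_\Omega p$, $p^*=\sup_\Omega p$; $p'$ is defined by $1/p(x)+1/p'(x)=1$. Functions are $\mu$-measurable, and functions on $\Omega$ (including $f/w$ and $|f|^{p/s}w^{-q/s}$) are extended by $0$ outside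 $\Omega$. A weight on $\Omega$ is a $\mu$-measurable function $w$ with $0<w<\infty$ $\mu$-a.e. For $0\le\alpha<\beta$ the centered fractional maximal function is $$M_\alpha f(x)=\sup_{\rho>0}\frac{1}{\mu(Q(x,\rho))^{1-\alpha/\beta}}\int_{Q(x,\rho)}|f(y)|\,d\mu(y),$$ and $M=M_0$ is the (centered) Hardy–Littlewood maximal function. *)

theory Defs
  imports "HOL-Analysis.Analysis"
begin

text \<open>The sets of \<open>M\<close> play the role of the \<open>\<mu>\<close>-measurable sets.  For a Borel regular outer measure,
  \<open>M\<close> is its restriction to the Caratheodory measurable sets; completeness is not required here.\<close>

definition borel_regular :: "'a::topological_space measure \<Rightarrow> bool" where
  "borel_regular M \<longleftrightarrow> space M = UNIV \<and> sets borel \<subseteq> sets M \<and>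
     (\<forall>A\<in>sets M. \<exists>B\<in>sets borel. A \<subseteq> B \<and> emeasure M B = emeasure M A)"

text \<open>Cubes are closed, and the second argument is the side length (not half of it).\<close>

definition cube :: "real^'n \<Rightarrow> real \<Rightarrow> (real^'n) set" where
  "cube x l = {y. \<forall>i. \<bar>y $ i - x $ i\<bar> \<le> l / 2}"

definition lower_ahlfors_regular :: "(real^'n) measure \<Rightarrow> real \<Rightarrow> (real^'n) set \<Rightarrow> bool" where
  "lower_ahlfors_regular M \<beta> \<Omega> \<longleftrightarrow> 0 < \<beta> \<and>
     (\<exists>c>0. \<forall>x\<in>\<Omega>. \<forall>l. 0 < l \<and> l < diameter \<Omega> \<longrightarrow> ennreal (c * l powr \<beta>) \<le> emeasure M (cube x l))"

definition is_exponent :: "'a measure \<Rightarrow> 'a set \<Rightarrow> ('a \<Rightarrow> real) \<Rightarrow> bool" where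
  "is_exponent M \<Omega> p \<longleftrightarrow> p \<in> borel_measurable (restrict_space M \<Omega>) \<and> (\<forall>x\<in>\<Omega>. 1 \<le> p x)"

text \<open>The infimum and supremum are taken in the extended reals, so that they are meaningful
  also for unbounded exponents.\<close>

definition exp_inf :: "'a set \<Rightarrow> ('a \<Rightarrow> real) \<Rightarrow> ereal" where
  "exp_inf \<Omega> p = (INF x\<in>\<Omega>. ereal (p x))"

definition exp_sup :: "'a set \<Rightarrow> ('a \<Rightarrow> real) \<Rightarrow> ereal" where
  "exp_sup \<Omega> p = (SUP x\<in>\<Omega>. ereal (p x))"

definition is_weight :: "'a measure \<Rightarrow> 'a set \<Rightarrow> ('a \<Rightarrow> ereal) \<Rightarrow> bool" where
  "is_weight M \<Omega> w \<longleftrightarrow> w \<in> borel_measurable (restrict_space M \<Omega>) \<and>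
     (AE x in M. x \<in> \<Omega> \<longrightarrow> 0 < w x \<and> w x < \<infinity>)"

definition zero_ext :: "'a set \<Rightarrow> ('a \<Rightarrow> ereal) \<Rightarrow> 'a \<Rightarrow> ereal" where
  "zero_ext \<Omega> f y = (if y \<in> \<Omega> then f y else 0)"

text \<open>Real powers on \<open>[0, \<infinity>]\<close>, with \<open>0\<^sup>a = \<infinity>\<close> and \<open>\<infinity>\<^sup>a = 0\<close> for \<open>a < 0\<close>
  and with \<open>x\<^sup>0 = 1\<close> throughout.\<close>

definition epowr :: "ennreal \<Rightarrow> real \<Rightarrow> ennreal" where
  "epowr x a =
     (if a = 0 then 1
      else if x = 0 then (if 0 < a then 0 else \<infinity>)
      else if x = \<infinity> then (if 0 < a then \<infinity> else 0)
      else ennreal (enn2real x powr a))"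

text \<open>In \<open>ennreal\<close>, both \<open>0 / 0\<close> and \<open>\<infinity> / \<infinity>\<close> are \<open>0\<close>: a cube of measure zero or of
  infinite measure contributes nothing to the supremum.\<close>

definition frac_maximal ::
    "(real^'n) measure \<Rightarrow> real \<Rightarrow> real \<Rightarrow> (real^'n \<Rightarrow> ereal) \<Rightarrow> real^'n \<Rightarrow> ennreal" where
  "frac_maximal M \<beta> \<alpha> f x =
     (SUP \<rho>\<in>{0<..}. (\<integral>\<^sup>+ y\<in>cube x \<rho>. e2ennreal \<bar>f y\<bar> \<partial>M) / epowr (emeasure M (cube x \<rho>)) (1 - \<alpha> / \<beta>))"

text \<open>The value does not depend on \<open>\<beta>\<close>, since \<open>1 - 0 / \<beta> = 1\<close>.\<close>

abbreviation hl_maximal ::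
    "(real^'n) measure \<Rightarrow> real \<Rightarrow> (real^'n \<Rightarrow> ereal) \<Rightarrow> real^'n \<Rightarrow> ennreal" where
  "hl_maximal M \<beta> \<equiv> frac_maximal M \<beta> 0"

end

theory Submission
  imports Defs
begin

text \<open>
  The estimate is the Hoelder inequality with constant exponents, although \<open>p\<close>, \<open>q\<close> and \<open>s\<close> vary.
  Put \<open>\<theta> = 1 - \<alpha> / \<beta>\<close>.  Since \<open>1 / p' = 1 - 1 / p\<close>, the quotient \<open>s / q = 1 / q + 1 / p'\<close> is equal to
  \<open>\<theta>\<close> at every point (\<open>Sobolev_exponent_identities\<close>).  For \<open>g = |f|\<^sup>p\<^sup>/\<^sup>s w\<^sup>-\<^sup>q\<^sup>/\<^sup>s\<close> it follows that
  \<open>g\<^sup>\<theta> = |f|\<^sup>p\<^sup>/\<^sup>q / w\<close>, where \<open>p / q = 1 - p (1 - \<theta>)\<close>, and therefore \<open>|f| / w\<close> is the product of \<open>g\<^sup>\<theta>\<close>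
  and the power \<open>1 - \<theta> = \<alpha> / \<beta>\<close> of \<open>|f|\<^sup>p\<close> (\<open>weighted_quotient_factorization\<close>).

  Hoelder with the conjugate exponents \<open>1 / \<theta>\<close> and \<open>1 / (1 - \<theta>)\<close> on the part of a cube \<open>Q\<close> inside \<open>\<Omega>\<close>
  (\<open>nn_integral_Holder\<close>) bounds the integral of \<open>|f| / w\<close> over \<open>Q\<close> by the \<open>\<theta>\<close>-th power of the integral of
  \<open>g\<close> times the required power of the integral of \<open>|f|\<^sup>p\<close>.  The normalization \<open>\<mu>(Q)\<^sup>\<theta>\<close> in the
  fractional maximal function is exactly what turns the first factor into the \<open>\<theta>\<close>-th power of the
  mean of \<open>g\<close> over \<open>Q\<close>, which the Hardy-Littlewood maximal function dominates.

  All integrals and powers take values in \<open>[0, \<infinity>]\<close>, with \<open>0 \<cdot> \<infinity> = 0\<close>.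
\<close>

section \<open>Powers on the extended half-line\<close>

text \<open>The case distinction that matches the definition of \<open>epowr\<close>.\<close>

lemma ennreal_zero_real_top_cases:
  fixes x :: ennreal
  obtains "x = 0" | r where "0 < r" "x = ennreal r" | "x = top"
  by (metis ennreal_cases ennreal_eq_0_iff not_less)

lemma epowr_ennreal: "0 < r \<Longrightarrow> epowr (ennreal r) a = ennreal (r powr a)"
  by (auto simp: epowr_def)

lemma epowr_0: "0 < a \<Longrightarrow> epowr 0 a = 0"
  by (auto simp: epowr_def)

lemma epowr_top: "0 < a \<Longrightarrow> epowr top a = top"
  by (auto simp: epowr_def)

lemma epowr_one: "epowr x 1 = x"
  by (cases x rule: ennreal_zero_real_top_cases) (auto simp: epowr_0 epowr_ennreal epowr_top)

lemma epowr_mono: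
  assumes "0 < a" "x \<le> y"
  shows "epowr x a \<le> epowr y a"
  using assms
  by (cases x rule: ennreal_zero_real_top_cases; cases y rule: ennreal_zero_real_top_cases)
    (auto simp: epowr_0 epowr_ennreal epowr_top top_unique intro!: powr_mono2)

text \<open>
  This includes the divisors \<open>0\<close> and \<open>\<infinity>\<close>, because \<open>0 / 0 = \<infinity> / \<infinity> = 0\<close>; cubes of measure \<open>0\<close> or \<open>\<infinity>\<close>
  therefore need no separate treatment when averages are formed.
\<close>

lemma epowr_divide:
  assumes "0 < a"
  shows "epowr (x / m) a = epowr x a / epowr m a"
  using assms
  by (cases x rule: ennreal_zero_real_top_cases; cases m rule: ennreal_zero_real_top_cases)
    (auto simp: epowr_0 epowr_ennreal epowr_top divide_ennreal powr_divide ennreal_top_divide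
      ennreal_divide_top ennreal_divide_zero)

lemma measurable_epowr [measurable (raw)]:
  assumes [measurable]: "g \<in> borel_measurable N" "e \<in> borel_measurable N"
  shows "(\<lambda>y. epowr (g y) (e y)) \<in> borel_measurable N"
  unfolding epowr_def by measurable

section \<open>The Hoelder inequality in product form\<close>

text \<open>
  Weighted arithmetic-geometric mean for \<open>u / A\<close> and \<open>v / B\<close>, multiplied through by \<open>A\<^sup>\<theta> B\<^sup>1\<^sup>-\<^sup>\<theta>\<close>.
  The right-hand side is linear in \<open>u\<close> and \<open>v\<close>, so it can be integrated, and the two scales are free
  so that they can be chosen as the integrals of the two functions.
\<close>

lemma epowr_Young:
  assumes \<theta>: "0 < \<theta>" "\<theta> < 1" and A: "0 < A" and B: "0 < B"
  shows "epowr u \<theta> * epowr v (1 - \<theta>)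
    \<le> ennreal (A powr \<theta> * B powr (1 - \<theta>)) * (ennreal (\<theta> / A) * u + ennreal ((1 - \<theta>) / B) * v)"
proof -
  have real: "r powr \<theta> * t powr (1 - \<theta>)
      \<le> (A powr \<theta> * B powr (1 - \<theta>)) * (\<theta> / A * r + (1 - \<theta>) / B * t)" if "0 < r" "0 < t" for r t
  proof -
    have "(r / A) powr \<theta> * (t / B) powr (1 - \<theta>) \<le> \<theta> * (r / A) + (1 - \<theta>) * (t / B)"
      using that A B \<theta> by (intro Youngs_inequality_0) auto
    moreover have "r powr \<theta> * t powr (1 - \<theta>)
        = (A powr \<theta> * B powr (1 - \<theta>)) * ((r / A) powr \<theta> * (t / B) powr (1 - \<theta>))"
      using that A B by (simp add: powr_divide)
    ultimately show ?thesis
      using A B by (auto intro!: mult_left_mono)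
  qed
  show ?thesis
    using \<theta> A B real
    by (cases u rule: ennreal_zero_real_top_cases; cases v rule: ennreal_zero_real_top_cases)
      (auto simp: epowr_0 epowr_ennreal epowr_top ennreal_mult_top ennreal_top_mult ennreal_mult[symmetric]
        ennreal_plus[symmetric] simp del: ennreal_plus)
qed

text \<open>
  If both integrals are positive and finite, integrating the preceding bound with \<open>A\<close> and \<open>B\<close> equal
  to them gives the claim, because the linear terms then add up to \<open>\<theta> + (1 - \<theta>) = 1\<close>.  The convention
  \<open>0 \<cdot> \<infinity> = 0\<close> is harmless on the right: if one integral vanishes, then so does that function almost
  everywhere, and with it the integrand on the left.
\<close>

lemma nn_integral_Holder:
  assumes [measurable]: "u \<in> borel_measurable N" "v \<in> borel_measurable N"
    and \<theta>: "0 < \<theta>" "\<theta> < 1"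
  shows "(\<integral>\<^sup>+ y. epowr (u y) \<theta> * epowr (v y) (1 - \<theta>) \<partial>N)
    \<le> epowr (\<integral>\<^sup>+ y. u y \<partial>N) \<theta> * epowr (\<integral>\<^sup>+ y. v y \<partial>N) (1 - \<theta>)"
    (is "?I \<le> epowr ?U \<theta> * epowr ?V (1 - \<theta>)")
proof -
  consider "?U = 0 \<or> ?V = 0" | "?U \<noteq> 0" "?V \<noteq> 0" "?U = top \<or> ?V = top"
    | A B where "0 < A" "?U = ennreal A" "0 < B" "?V = ennreal B"
    by (metis ennreal_zero_real_top_cases)
  then show ?thesis
  proof cases
    case 1
    then have "(AE y in N. u y = 0) \<or> (AE y in N. v y = 0)"
      by (simp add: nn_integral_0_iff_AE)
    then have "AE y in N. epowr (u y) \<theta> * epowr (v y) (1 - \<theta>) = 0"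
      using \<theta> by (auto simp: epowr_0)
    then have "?I = 0"
      by (simp add: nn_integral_0_iff_AE)
    then show ?thesis by simp
  next
    case 2
    then have "epowr ?U \<theta> * epowr ?V (1 - \<theta>) = top"
      using \<theta> by (cases ?U rule: ennreal_zero_real_top_cases; cases ?V rule: ennreal_zero_real_top_cases)
        (auto simp: epowr_ennreal epowr_top ennreal_mult_top ennreal_top_mult)
    then show ?thesis by simp
  next
    case 3
    let ?C = "ennreal (A powr \<theta> * B powr (1 - \<theta>))"
    have "?I \<le> (\<integral>\<^sup>+ y. ?C * (ennreal (\<theta> / A) * u y + ennreal ((1 - \<theta>) / B) * v y) \<partial>N)"
      using \<theta> 3 by (intro nn_integral_mono epowr_Young) auto
    also have "\<dots> = ?C * (ennreal (\<theta> / A) * ?U + ennreal ((1 - \<theta>) / B) * ?V)"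
      by (simp add: nn_integral_cmult nn_integral_add)
    also have "ennreal (\<theta> / A) * ?U + ennreal ((1 - \<theta>) / B) * ?V = 1"
      using \<theta> 3 by (simp add: ennreal_mult[symmetric] ennreal_plus[symmetric] del: ennreal_plus)
    also have "?C * 1 = epowr ?U \<theta> * epowr ?V (1 - \<theta>)"
      using 3 by (simp add: epowr_ennreal ennreal_mult)
    finally show ?thesis .
  qed
qed

section \<open>Exponents and the pointwise factorization\<close>

text \<open>
  In the application \<open>P\<close> is the value of \<open>p\<close> at a point, and \<open>P (1 - \<theta>) < 1\<close> is the condition
  \<open>p < \<beta> / \<alpha>\<close>.  It makes the first exponent of \<open>|a|\<close> positive, so that both factors are \<open>0\<close> for
  \<open>a = 0\<close> and both are \<open>\<infinity>\<close> for \<open>a = \<plusminus>\<infinity>\<close>; no product of the form \<open>0 \<cdot> \<infinity>\<close> occurs.  For other \<open>a\<close> the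
  exponents of \<open>|a|\<close> add up to \<open>1\<close>.
\<close>

lemma weighted_quotient_factorization:
  fixes a b :: ereal
  assumes b: "0 < b" "b < \<infinity>" and \<theta>: "0 < \<theta>" "\<theta> < 1" and P: "0 < P" "P * (1 - \<theta>) < 1"
  shows "e2ennreal \<bar>a / b\<bar>
    = epowr (epowr (e2ennreal \<bar>a\<bar>) ((1 - P * (1 - \<theta>)) / \<theta>) * epowr (e2ennreal b) (- (1 / \<theta>))) \<theta>
      * epowr (epowr (e2ennreal \<bar>a\<bar>) P) (1 - \<theta>)"
proof -
  obtain c where c: "b = ereal c" "0 < c"
    using b by (cases b) auto
  have e: "0 < (1 - P * (1 - \<theta>)) / \<theta>"
    using P \<theta> by simp
  have b': "e2ennreal (ereal c) = ennreal c"
    using c by (simp add: ennreal.abs_eq[symmetric] e2ennreal_ereal)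
  have q: "e2ennreal \<bar>a / ereal c\<bar> = e2ennreal \<bar>a\<bar> / ennreal c"
    using c
    by (cases a) (auto simp: e2ennreal_ereal divide_ennreal ennreal_top_divide e2ennreal_infty)
  show ?thesis
  proof (cases "e2ennreal \<bar>a\<bar>" rule: ennreal_zero_real_top_cases)
    case 1
    then show ?thesis using e P \<theta> c by (simp add: q epowr_0)
  next
    case (2 r)
    have "(r powr ((1 - P * (1 - \<theta>)) / \<theta>) * c powr (- (1 / \<theta>))) powr \<theta> * (r powr P) powr (1 - \<theta>) = r / c"
      using 2 c \<theta>
      by (simp add: powr_mult powr_divide powr_powr powr_minus_divide powr_add[symmetric])
    then show ?thesis
      using 2 c by (simp add: q b' epowr_ennreal ennreal_mult[symmetric] divide_ennreal)
  next
    case 3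
    then show ?thesis using e P \<theta> c
      by (simp add: q b' epowr_top epowr_ennreal ennreal_top_divide ennreal_top_mult)
  qed
qed

text \<open>
  The reason why variable exponents cause no difficulty here: at each point \<open>s / q\<close> and the exponent
  \<open>q / s\<close> of the weight depend on \<open>\<alpha>\<close> and \<open>\<beta>\<close> alone.
\<close>

lemma Sobolev_exponent_identities:
  fixes \<alpha> \<beta> p p' q s :: real
  assumes "0 < \<alpha>" "\<alpha> < \<beta>" "1 < p" "p < \<beta> / \<alpha>"
    and p': "1 / p + 1 / p' = 1" and q: "1 / q = 1 / p - \<alpha> / \<beta>" and s: "s = 1 + q / p'"
  shows "s / q = 1 - \<alpha> / \<beta>" "q / s = 1 / (1 - \<alpha> / \<beta>)"
    "p / s = (1 - p * (\<alpha> / \<beta>)) / (1 - \<alpha> / \<beta>)"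
proof -
  have "p * \<alpha> < \<beta>"
    using assms by (simp add: field_simps)
  then have "0 < 1 / q"
    unfolding q using assms by (simp add: field_simps)
  then have q0: "0 < q" by simp
  have "s / q = 1 / q + 1 / p'"
    using q0 by (simp add: s field_simps)
  also have "\<dots> = 1 - \<alpha> / \<beta>"
    using p' q by linarith
  finally show sq: "s / q = 1 - \<alpha> / \<beta>" .
  then show "q / s = 1 / (1 - \<alpha> / \<beta>)"
    by (metis inverse_divide inverse_eq_divide)
  have "p / s = p * (1 / q) / (s / q)"
    using q0 by simp
  also have "p * (1 / q) = 1 - p * (\<alpha> / \<beta>)"
    unfolding q using assms by (simp add: right_diff_distrib)
  finally show "p / s = (1 - p * (\<alpha> / \<beta>)) / (1 - \<alpha> / \<beta>)"
    unfolding sq .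
qed

section \<open>Comparison of the maximal functions\<close>

text \<open>
  Functions on \<open>\<Omega>\<close> are measurable only with respect to the restricted measure space, so the integrals in
  a maximal function are moved there before Hoelder is applied.
\<close>

lemma set_nn_integral_zero_ext:
  assumes "A \<inter> \<Omega> \<inter> space M \<in> sets M"
  shows "(\<integral>\<^sup>+ y\<in>A. e2ennreal \<bar>zero_ext \<Omega> h y\<bar> \<partial>M)
    = (\<integral>\<^sup>+ y. e2ennreal \<bar>h y\<bar> \<partial>restrict_space M (A \<inter> \<Omega>))"
  unfolding nn_integral_restrict_space[OF assms]
  by (intro nn_integral_cong) (auto simp: zero_ext_def indicator_def e2ennreal_neg)

lemma closed_cube: "closed (cube x l)"
proof -
  have "cube x l = (\<Inter>i. {y. \<bar>y $ i - x $ i\<bar> \<le> l / 2})"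
    by (auto simp: cube_def)
  then show ?thesis
    by (auto intro!: closed_INT closed_Collect_le continuous_intros)
qed

theorem lemma2p8:
  fixes M :: "(real^'n) measure" and \<Omega> :: "(real^'n) set"
    and \<alpha> \<beta> :: real and p p' q s :: "real^'n \<Rightarrow> real"
    and f w :: "real^'n \<Rightarrow> ereal"
  assumes "borel_regular M"
    and "bounded \<Omega>" and "\<Omega> \<in> sets M"
    and "lower_ahlfors_regular M \<beta> \<Omega>"
    and "0 < \<alpha>" and "\<alpha> < \<beta>"
    and "is_exponent M \<Omega> p"
    and "1 < exp_inf \<Omega> p"
    and "\<forall>x\<in>\<Omega>. exp_inf \<Omega> p \<le> ereal (p x) \<and> ereal (p x) \<le> exp_sup \<Omega> p"
    and "exp_sup \<Omega> p < ereal (\<beta> / \<alpha>)"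
    and p': "\<forall>x\<in>\<Omega>. 1 / p x + 1 / p' x = 1"
    and q: "\<forall>x\<in>\<Omega>. 1 / q x = 1 / p x - \<alpha> / \<beta>"
    and s: "\<forall>x\<in>\<Omega>. s x = 1 + q x / p' x"
    and "f \<in> borel_measurable (restrict_space M \<Omega>)"
    and "is_weight M \<Omega> w"
    and "x \<in> \<Omega>"
  shows "frac_maximal M \<beta> \<alpha> (zero_ext \<Omega> (\<lambda>y. f y / w y)) x
    \<le> epowr
        (hl_maximal M \<beta>
          (zero_ext \<Omega> (\<lambda>y. enn2ereal
             (epowr (e2ennreal \<bar>f y\<bar>) (p y / s y) * epowr (e2ennreal (w y)) (- (q y / s y))))) x)
        (s x / q x)
      * epowr (\<integral>\<^sup>+ y\<in>\<Omega>. epowr (e2ennreal \<bar>f y\<bar>) (p y) \<partial>M) (\<alpha> / \<beta>)"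
proof -
  define \<theta> where "\<theta> = 1 - \<alpha> / \<beta>"
  define F where "F = (\<lambda>y. epowr (e2ennreal \<bar>f y\<bar>) (p y))"
  define g where "g = (\<lambda>y. epowr (e2ennreal \<bar>f y\<bar>) (p y / s y) * epowr (e2ennreal (w y)) (- (q y / s y)))"
  define g\<^sub>0 where "g\<^sub>0 = zero_ext \<Omega> (\<lambda>y. enn2ereal (g y))"
  have \<theta>: "0 < \<theta>" "\<theta> < 1" "1 - \<theta> = \<alpha> / \<beta>"
    using \<open>0 < \<alpha>\<close> \<open>\<alpha> < \<beta>\<close> by (auto simp: \<theta>_def)
  have p: "1 < p y" "p y < \<beta> / \<alpha>" if "y \<in> \<Omega>" for y
  proof -
    have "1 < ereal (p y)" "ereal (p y) < ereal (\<beta> / \<alpha>)"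
      using assms(8-10) that by (meson less_le_trans le_less_trans)+
    then show "1 < p y" "p y < \<beta> / \<alpha>" by auto
  qed
  have exponents: "s y / q y = \<theta>" "q y / s y = 1 / \<theta>" "p y / s y = (1 - p y * (1 - \<theta>)) / \<theta>"
    if "y \<in> \<Omega>" for y
    using Sobolev_exponent_identities[OF \<open>0 < \<alpha>\<close> \<open>\<alpha> < \<beta>\<close> p[OF that], of "p' y" "q y" "s y"] that p' q s
    by (auto simp: \<theta>_def)
  have [measurable]: "cube x \<rho> \<in> sets M" for \<rho>
    using \<open>borel_regular M\<close> borel_closed[OF closed_cube] by (auto simp: borel_regular_def)
  note [measurable] = \<open>\<Omega> \<in> sets M\<close>

  have "(\<integral>\<^sup>+ y\<in>cube x \<rho>. e2ennreal \<bar>zero_ext \<Omega> (\<lambda>y. f y / w y) y\<bar> \<partial>M) / epowr (emeasure M (cube x \<rho>)) \<theta>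
      \<le> epowr (hl_maximal M \<beta> g\<^sub>0 x) \<theta> * epowr (\<integral>\<^sup>+ y\<in>\<Omega>. F y \<partial>M) (1 - \<theta>)"
    (is "?I / epowr ?m \<theta> \<le> _ * epowr ?F _") if "0 < \<rho>" for \<rho>
  proof -
    define D where "D = cube x \<rho> \<inter> \<Omega>"
    define N where "N = restrict_space M D"
    have D: "D \<inter> space M \<in> sets M"
      unfolding D_def by measurable
    have [measurable]: "f \<in> borel_measurable N" "w \<in> borel_measurable N" "p \<in> borel_measurable N"
      using \<open>f \<in> _\<close> \<open>is_weight M \<Omega> w\<close> \<open>is_exponent M \<Omega> p\<close>
      by (auto simp: N_def D_def is_weight_def is_exponent_def intro: measurable_restrict_mono)
    have space_N: "y \<in> \<Omega>" if "y \<in> space N" for y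
      using that by (simp add: N_def D_def space_restrict_space)
    \<comment> \<open>Rewriting the exponents of \<open>g\<close> in terms of \<open>p\<close> makes its measurability a consequence of that of \<open>p\<close>.\<close>
    have "(\<lambda>y. epowr (e2ennreal \<bar>f y\<bar>) ((1 - p y * (1 - \<theta>)) / \<theta>) * epowr (e2ennreal (w y)) (- (1 / \<theta>)))
        \<in> borel_measurable N"
      by measurable
    then have [measurable]: "g \<in> borel_measurable N"
      by (rule measurable_cong[THEN iffD1, rotated]) (auto simp: g_def exponents dest!: space_N)
    have [measurable]: "F \<in> borel_measurable N"
      unfolding F_def by measurable
    have w: "AE y in N. 0 < w y \<and> w y < \<infinity>"
      using \<open>is_weight M \<Omega> w\<close> unfolding N_def AE_restrict_space_iff[OF D] is_weight_def
      by (elim conjE eventually_mono) (simp add: D_def)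
    have "?I = (\<integral>\<^sup>+ y. e2ennreal \<bar>f y / w y\<bar> \<partial>N)"
      using D unfolding N_def D_def by (rule set_nn_integral_zero_ext)
    also have "\<dots> = (\<integral>\<^sup>+ y. epowr (g y) \<theta> * epowr (F y) (1 - \<theta>) \<partial>N)"
    proof (rule nn_integral_cong_AE, use w AE_space in eventually_elim)
      case (elim y)
      then have y: "y \<in> \<Omega>" by (simp add: space_N)
      have "p y * (1 - \<theta>) < 1"
        using p[OF y] \<open>0 < \<alpha>\<close> \<open>\<alpha> < \<beta>\<close> by (simp add: \<theta>_def field_simps)
      then show ?case
        using elim p(1)[OF y] \<theta> unfolding F_def g_def exponents[OF y]
        by (intro weighted_quotient_factorization) auto
    qed
    also have "\<dots> \<le> epowr (\<integral>\<^sup>+ y. g y \<partial>N) \<theta> * epowr (\<integral>\<^sup>+ y. F y \<partial>N) (1 - \<theta>)"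
      using \<theta> by (intro nn_integral_Holder) auto
    also have "(\<integral>\<^sup>+ y. g y \<partial>N) = (\<integral>\<^sup>+ y\<in>cube x \<rho>. e2ennreal \<bar>g\<^sub>0 y\<bar> \<partial>M)" (is "_ = ?G")
      using set_nn_integral_zero_ext[OF D[unfolded D_def], of "\<lambda>y. enn2ereal (g y)"]
      by (simp add: g\<^sub>0_def N_def D_def)
    also have "(\<integral>\<^sup>+ y. F y \<partial>N) \<le> ?F"
      unfolding N_def nn_integral_restrict_space[OF D]
      by (intro nn_integral_mono) (auto simp: D_def indicator_def)
    then have "epowr ?G \<theta> * epowr (\<integral>\<^sup>+ y. F y \<partial>N) (1 - \<theta>) \<le> epowr ?G \<theta> * epowr ?F (1 - \<theta>)"
      using \<theta> by (intro mult_left_mono epowr_mono) auto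
    finally have I: "?I \<le> epowr ?G \<theta> * epowr ?F (1 - \<theta>)" .
    have "?I / epowr ?m \<theta> \<le> epowr ?G \<theta> * epowr ?F (1 - \<theta>) / epowr ?m \<theta>"
      using I by (rule divide_right_mono_ennreal)
    also have "\<dots> = epowr (?G / ?m) \<theta> * epowr ?F (1 - \<theta>)"
      using \<theta> by (simp add: epowr_divide ennreal_times_divide mult.commute)
    also have "?G / ?m \<le> hl_maximal M \<beta> g\<^sub>0 x"
      unfolding frac_maximal_def using \<open>0 < \<rho>\<close> by (intro SUP_upper2[of \<rho>]) (auto simp: epowr_one)
    then have "epowr (?G / ?m) \<theta> * epowr ?F (1 - \<theta>)
        \<le> epowr (hl_maximal M \<beta> g\<^sub>0 x) \<theta> * epowr ?F (1 - \<theta>)"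
      using \<theta> by (intro mult_right_mono epowr_mono) auto
    finally show ?thesis .
  qed
  then have "frac_maximal M \<beta> \<alpha> (zero_ext \<Omega> (\<lambda>y. f y / w y)) x
      \<le> epowr (hl_maximal M \<beta> g\<^sub>0 x) \<theta> * epowr (\<integral>\<^sup>+ y\<in>\<Omega>. F y \<partial>M) (1 - \<theta>)"
    unfolding frac_maximal_def[of M \<beta> \<alpha>] \<theta>_def by (intro SUP_least) auto
  then show ?thesis
    unfolding exponents(1)[OF \<open>x \<in> \<Omega>\<close>] g\<^sub>0_def g_def F_def \<theta>(3) .
qed

end
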